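(* For any large prime $p\geq 2$, the finite field $\mathbb{F}_p$ contains squarefree primitive roots. Furthermore, the total number $N_2(p)$ of squarefree primitive roots satisfies $$N_2(p)=\prod_{q\geq 2}\left(1-\frac{1}{q^2}\right)\left(\frac{\varphi(p-1)}{p}\right)p+O\left(p^{1-\varepsilon}\right),$$ where the product is over all primes $q$ and $\varepsilon>0$ is an arbitrarily small number.
   Context: An element $\alpha\in\mathbb{F}_p$ is a primitive root if its multiplicative order $\mathrm{ord}_p(\alpha)$ equals $p-1$. Elements $n\in\mathbb{F}_p$ are identified with their integer representatives $0\leq n\leq p-1$. With $\mu$ the Möbius function ($\mu^2$ is the characteristic function of squarefree integers), $$N_2(p)=\#\{n\in\mathbb{F}_p:\ \mathrm{ord}_p(n)=p-1 \text{ and } \mu^2(n)=1\}.$$ $\varphi$ is Euler's totient function. "Large prime" means $p$ sufficiently large, and asymptotics are for $p\to\infty$. *)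

theory Defs
  imports "HOL-Analysis.Analysis" "HOL-Number_Theory.Number_Theory"
    "HOL-Computational_Algebra.Squarefree" "HOL-Library.Landau_Symbols"
begin

text \<open>Elements of the field with \<open>p\<close> elements are represented by the integers \<open>0, \<dots>, p - 1\<close>.
  The library function \<open>ord p n\<close> is the order of \<open>n\<close> modulo \<open>p\<close>, with value \<open>0\<close> when \<open>n\<close> is not
  coprime to \<open>p\<close>; hence \<open>n = 0\<close> is never a primitive root modulo a prime.\<close>

definition primitive_root :: "nat \<Rightarrow> nat \<Rightarrow> bool" where
  "primitive_root p n \<longleftrightarrow> n < p \<and> ord p n = p - 1"

definition moebius_mu :: "nat \<Rightarrow> int" where
  "moebius_mu n = (if squarefree n then (- 1) ^ card (prime_factors n) else 0)"

definition N2 :: "nat \<Rightarrow> nat" where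
  "N2 p = card {n. primitive_root p n \<and> (moebius_mu n)\<^sup>2 = 1}"

text \<open>The product over all primes is written as a product over \<open>nat\<close> with factor \<open>1\<close> at
  non-primes.  Since \<open>prodinf\<close> is unspecified for divergent products, convergence is recorded
  as well.\<close>

definition squarefree_factor :: "nat \<Rightarrow> real" where
  "squarefree_factor q = (if prime q then 1 - 1 / (real q)\<^sup>2 else 1)"

lemma convergent_prod_squarefree_factor: "convergent_prod squarefree_factor"
proof -
  have "summable (\<lambda>q. norm (squarefree_factor q - 1))"
  proof (rule summable_comparison_test')
    show "summable (\<lambda>q. inverse (real q ^ 2))"
      by (rule inverse_power_summable) simp
    show "norm (norm (squarefree_factor q - 1)) \<le> inverse (real q ^ 2)" if "q \<ge> 0" for q
      by (simp add: squarefree_factor_def field_simps)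
  qed
  then show ?thesis
    by (intro abs_convergent_prod_imp_convergent_prod summable_imp_abs_convergent_prod)
qed

end

theory Submission
  imports Defs "HOL-Real_Asymp.Real_Asymp"
begin

text \<open>For \<open>d \<le> D\<close>, the primitive roots divisible by \<open>d\<^sup>2\<close> are counted by additive Fourier analysis
  modulo \<open>p\<close>. The exponential sum over a subgroup of the units is at most \<open>\<surd>p\<close>, and
  inclusion-exclusion over the prime factors of \<open>p - 1\<close> turns this into the bound
  \<open>2\<^sup>\<omega> \<surd>p\<close> for primitive roots, where \<open>\<omega>\<close> is the number of prime factors of \<open>p - 1\<close>;
  hence the count is \<open>\<phi>(p - 1) / d\<^sup>2 + O(2\<^sup>\<omega> \<surd>p log p)\<close>. For \<open>d > D\<close> there are at most \<open>p / d\<^sup>2\<close>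
  such elements. Summing against \<open>\<mu>(d)\<close> with \<open>D\<close> near \<open>p\<close> to the power \<open>1/4\<close> gives the error term,
  since \<open>2\<^sup>\<omega>\<close> is smaller than any power of \<open>p\<close>.\<close>

section \<open>Exponential sums over sets of residues\<close>

definition additive_char :: "nat \<Rightarrow> int \<Rightarrow> complex" where
  "additive_char p k = cis (2 * pi * of_int k / of_nat p)"

lemma additive_char_0 [simp]: "additive_char p 0 = 1"
  by (simp add: additive_char_def)

lemma additive_char_add: "additive_char p (a + b) = additive_char p a * additive_char p b"
  by (simp add: additive_char_def cis_mult add_divide_distrib distrib_left)

lemma cnj_additive_char: "cnj (additive_char p a) = additive_char p (- a)"
  by (simp add: additive_char_def cis_cnj)

lemma norm_additive_char [simp]: "norm (additive_char p a) = 1"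
  by (simp add: additive_char_def)

lemma additive_char_mult: "additive_char p (int n * a) = additive_char p a ^ n"
proof -
  have "2 * pi * of_int (int n * a) / of_nat p = real n * (2 * pi * of_int a / of_nat p)"
    by simp
  then show ?thesis
    by (simp only: additive_char_def Complex.DeMoivre)
qed

lemma additive_char_eq_1_iff:
  assumes "p > 0"
  shows "additive_char p a = 1 \<longleftrightarrow> int p dvd a"
proof -
  have "additive_char p a = 1 \<longleftrightarrow> (\<exists>n. real_of_int a = real_of_int (n * int p))"
    using assms by (simp add: additive_char_def cis_conv_exp exp_eq_1 field_simps)
  also have "\<dots> \<longleftrightarrow> int p dvd a"
    by (metis dvd_def mult.commute of_int_eq_iff)
  finally show ?thesis .
qed

lemma additive_char_cong:
  assumes "p > 0" "[a = b] (mod int p)"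
  shows "additive_char p a = additive_char p b"
proof -
  have "int p dvd a - b"
    using assms by (simp add: cong_iff_dvd_diff)
  then have "additive_char p (a - b) = 1"
    using assms by (simp add: additive_char_eq_1_iff)
  then show ?thesis
    using additive_char_add[of p "a - b" b] by simp
qed

lemma additive_char_cong_nat:
  assumes "p > 0" "[a = b] (mod p)"
  shows "additive_char p (int a) = additive_char p (int b)"
  using assms by (intro additive_char_cong) (simp_all add: cong_int_iff)

text \<open>Orthogonality: the sum is geometric with ratio \<open>additive_char p k\<close>, a p-th
  root of unity, so it vanishes unless that ratio is 1.\<close>

lemma sum_additive_char:
  assumes "p > 0"
  shows "(\<Sum>a<p. additive_char p (int a * k)) = (if int p dvd k then of_nat p else 0)"
proof (cases "int p dvd k")
  case True
  then have "additive_char p (int a * k) = 1" for a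
    using assms by (simp add: additive_char_eq_1_iff)
  with True show ?thesis by simp
next
  case False
  have "additive_char p k ^ p = 1"
    using assms by (simp add: additive_char_eq_1_iff flip: additive_char_mult)
  moreover have "additive_char p k \<noteq> 1"
    using False assms by (simp add: additive_char_eq_1_iff)
  ultimately show ?thesis
    using False by (simp add: additive_char_mult sum_gp_strict)
qed

text \<open>Up to sign convention and normalisation, the discrete Fourier transform modulo
  \<open>p\<close> of the indicator function of \<open>X\<close>.\<close>

definition exp_sum :: "nat \<Rightarrow> nat set \<Rightarrow> nat \<Rightarrow> complex" where
  "exp_sum p X a = (\<Sum>n\<in>X. additive_char p (int (a * n)))"

lemma exp_sum_cong:
  assumes "p > 0" "[a = b] (mod p)"
  shows "exp_sum p X a = exp_sum p X b"
  unfolding exp_sum_def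
  by (intro sum.cong refl additive_char_cong_nat cong_mult assms) auto

lemma exp_sum_0: "exp_sum p X 0 = of_nat (card X)"
  by (simp add: exp_sum_def)

lemma int_dvd_diff_nat_iff:
  assumes "m < p" "n < p"
  shows "int p dvd int m - int n \<longleftrightarrow> m = n"
proof -
  have "int p dvd int m - int n \<longleftrightarrow> [m = n] (mod p)"
    by (simp add: cong_iff_dvd_diff flip: cong_int_iff)
  then show ?thesis
    using assms by (auto simp: cong_def)
qed

text \<open>Plancherel for two indicator functions. Residues below \<open>p\<close> are congruent
  only if equal, so orthogonality leaves just the diagonal \<open>m = n\<close>.\<close>

lemma sum_exp_sum_cnj:
  assumes "X \<subseteq> {..<p}" "Y \<subseteq> {..<p}"
  shows "(\<Sum>a<p. exp_sum p X a * cnj (exp_sum p Y a)) = of_nat p * of_nat (card (X \<inter> Y))"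
proof (cases "p = 0")
  case False
  have fin: "finite X" "finite Y"
    using assms finite_subset by blast+
  have "(\<Sum>a<p. exp_sum p X a * cnj (exp_sum p Y a)) =
      (\<Sum>a<p. \<Sum>m\<in>X. \<Sum>n\<in>Y. additive_char p (int a * (int m - int n)))"
    by (simp add: exp_sum_def sum_product cnj_additive_char right_diff_distrib
        flip: additive_char_add)
  also have "\<dots> = (\<Sum>m\<in>X. \<Sum>a<p. \<Sum>n\<in>Y. additive_char p (int a * (int m - int n)))"
    by (rule sum.swap)
  also have "\<dots> = (\<Sum>m\<in>X. \<Sum>n\<in>Y. \<Sum>a<p. additive_char p (int a * (int m - int n)))"
    by (intro sum.cong refl sum.swap)
  also have "\<dots> = (\<Sum>m\<in>X. \<Sum>n\<in>Y. if m = n then of_nat p else 0)"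
    using False assms by (intro sum.cong refl) (auto simp: sum_additive_char int_dvd_diff_nat_iff subset_iff)
  also have "\<dots> = (\<Sum>m\<in>X. if m \<in> Y then of_nat p else 0)"
    using fin by (simp add: sum.delta')
  also have "\<dots> = (\<Sum>m\<in>X \<inter> Y. of_nat p)"
    using fin by (simp only: sum.inter_restrict)
  finally show ?thesis by (simp add: mult.commute)
qed auto

lemma parseval_exp_sum:
  assumes "X \<subseteq> {..<p}"
  shows "(\<Sum>a<p. (norm (exp_sum p X a))\<^sup>2) = real p * real (card X)"
proof -
  have "complex_of_real (\<Sum>a<p. (norm (exp_sum p X a))\<^sup>2) =
      (\<Sum>a<p. exp_sum p X a * cnj (exp_sum p X a))"
    by (simp only: of_real_sum complex_norm_square)
  also have "\<dots> = complex_of_real (real p * real (card X))"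
    using sum_exp_sum_cnj[OF assms assms] by simp
  finally show ?thesis
    by (simp only: of_real_eq_iff)
qed

section \<open>Square-root cancellation over subgroups and over sets cut out by power
  conditions\<close>

lemma mult_mod_prime_inj_on:
  fixes a p :: nat
  assumes "prime p" "\<not> p dvd a"
  shows "inj_on (\<lambda>h. a * h mod p) {..<p}"
proof (rule inj_onI)
  fix x y
  assume xy: "x \<in> {..<p}" "y \<in> {..<p}" "a * x mod p = a * y mod p"
  have "coprime a p"
    using assms by (metis coprime_commute prime_imp_coprime)
  moreover have "[a * x = a * y] (mod p)"
    using xy(3) by (simp add: cong_def)
  ultimately have "[x = y] (mod p)"
    by (simp add: cong_mult_lcancel_nat)
  then show "x = y"
    using xy by (simp add: cong_def)
qed

text \<open>The sum is constant on the coset \<open>a H\<close>, so Parseval's identity over that coset alone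
  already gives square-root cancellation.\<close>

lemma norm_exp_sum_subgroup_le:
  assumes p: "prime p" and H: "H \<subseteq> {1..<p}" "H \<noteq> {}"
    and closed: "\<And>h k. h \<in> H \<Longrightarrow> k \<in> H \<Longrightarrow> h * k mod p \<in> H"
    and a: "\<not> p dvd a"
  shows "norm (exp_sum p H a) \<le> sqrt (real p)"
proof -
  have p0: "p > 0" using p by (simp add: prime_gt_0_nat)
  have fin: "finite H" using H finite_subset by blast
  have Hp: "H \<subseteq> {..<p}" using H by auto
  \<comment> \<open>Multiplication by \<open>h\<close> maps the finite set \<open>H\<close>
    injectively into itself, hence permutes it; reindexing by this permutation turns the frequency
    \<open>a\<close> into \<open>a * h\<close>.\<close>
  have inv: "exp_sum p H (a * h) = exp_sum p H a" if h: "h \<in> H" for h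
  proof -
    have "0 < h" "h < p" using h H by auto
    then have "\<not> p dvd h" by (auto dest: dvd_imp_le)
    then have inj: "inj_on (\<lambda>n. h * n mod p) H"
      using mult_mod_prime_inj_on[OF p] Hp inj_on_subset by blast
    then have "(\<lambda>n. h * n mod p) ` H = H"
      using closed[OF h] fin by (intro endo_inj_surj) auto
    then have "exp_sum p H a = (\<Sum>n\<in>(\<lambda>n. h * n mod p) ` H. additive_char p (int (a * n)))"
      by (simp add: exp_sum_def)
    also have "\<dots> = (\<Sum>n\<in>H. additive_char p (int (a * (h * n mod p))))"
      using inj by (simp add: sum.reindex)
    also have "\<dots> = exp_sum p H (a * h)"
      unfolding exp_sum_def
      by (intro sum.cong refl additive_char_cong_nat p0) (simp add: cong_def mod_mult_right_eq mult.assoc)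
    finally show ?thesis by simp
  qed
  have inja: "inj_on (\<lambda>h. a * h mod p) H"
    using mult_mod_prime_inj_on[OF p a] Hp inj_on_subset by blast
  have "real (card H) * (norm (exp_sum p H a))\<^sup>2 = (\<Sum>h\<in>H. (norm (exp_sum p H (a * h)))\<^sup>2)"
    by (simp add: inv)
  also have "\<dots> = (\<Sum>h\<in>H. (norm (exp_sum p H (a * h mod p)))\<^sup>2)"
    by (intro sum.cong refl arg_cong[where f = "\<lambda>z. (norm z)\<^sup>2"] exp_sum_cong p0) (simp add: cong_def)
  also have "\<dots> = (\<Sum>b\<in>(\<lambda>h. a * h mod p) ` H. (norm (exp_sum p H b))\<^sup>2)"
    using inja by (simp add: sum.reindex)
  also have "\<dots> \<le> (\<Sum>b<p. (norm (exp_sum p H b))\<^sup>2)"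
    using p0 by (intro sum_mono2) auto
  also have "\<dots> = real (card H) * real p"
    using parseval_exp_sum[OF Hp] by simp
  finally have "(norm (exp_sum p H a))\<^sup>2 \<le> real p"
    using fin H by (simp add: card_gt_0_iff)
  then show ?thesis
    by (simp add: real_le_rsqrt)
qed

text \<open>Each condition \<open>[n ^ k \<noteq> 1]\<close> is removed by writing the sum as a difference of
  two sums, one without the condition and one with its negation.\<close>

lemma norm_exp_sum_power_conditions_le:
  assumes p: "prime p" and S: "finite S" and a: "\<not> p dvd a"
  shows "norm (exp_sum p {n \<in> {1..<p}. (\<forall>k\<in>T. [n ^ k = 1] (mod p)) \<and>
      (\<forall>k\<in>S. [n ^ k \<noteq> 1] (mod p))} a) \<le> 2 ^ card S * sqrt (real p)"
  using S
\<comment> \<open>\<open>T\<close> must vary because the negation of a removed condition moves from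
  \<open>S\<close> into \<open>T\<close>.\<close>
proof (induction S arbitrary: T rule: finite_induct)
  case empty
  let ?H = "{n \<in> {1..<p}. \<forall>k\<in>T. [n ^ k = 1] (mod p)}"
  have "norm (exp_sum p ?H a) \<le> sqrt (real p)"
  \<comment> \<open>With no negative conditions left, the set is an intersection of kernels of power
    maps, so it is a subgroup of the units.\<close>
  proof (rule norm_exp_sum_subgroup_le[OF p _ _ _ a])
    have "1 \<in> ?H" using p prime_gt_1_nat by auto
    then show "?H \<noteq> {}" by blast
    fix h k assume hk: "h \<in> ?H" "k \<in> ?H"
    then have "\<not> p dvd h" "\<not> p dvd k" by (auto dest: dvd_imp_le)
    then have "\<not> p dvd h * k" using p by (simp add: prime_dvd_mult_iff)
    then have "h * k mod p \<in> {1..<p}"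
      using p by (auto simp: prime_gt_0_nat mod_greater_zero_iff_not_dvd Suc_le_eq)
    moreover have "[(h * k mod p) ^ i = 1] (mod p)" if "i \<in> T" for i
    proof -
      have "[(h * k mod p) ^ i = (h * k) ^ i] (mod p)"
        by (simp add: cong_def power_mod)
      also have "[(h * k) ^ i = 1 * 1] (mod p)"
        unfolding power_mult_distrib using hk that by (intro cong_mult) auto
      finally show ?thesis by simp
    qed
    ultimately show "h * k mod p \<in> ?H" by auto
  qed auto
  then show ?case by simp
next
  case (insert x S)
  let ?A = "\<lambda>T S. {n \<in> {1..<p}. (\<forall>k\<in>T. [n ^ k = 1] (mod p)) \<and> (\<forall>k\<in>S. [n ^ k \<noteq> 1] (mod p))}"
  have "?A T S = ?A T (insert x S) \<union> ?A (insert x T) S" by auto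
  moreover have "exp_sum p (?A T (insert x S) \<union> ?A (insert x T) S) a =
      exp_sum p (?A T (insert x S)) a + exp_sum p (?A (insert x T) S) a"
    unfolding exp_sum_def by (rule sum.union_disjoint) auto
  ultimately have "exp_sum p (?A T (insert x S)) a =
      exp_sum p (?A T S) a - exp_sum p (?A (insert x T) S) a" by simp
  then have "norm (exp_sum p (?A T (insert x S)) a) \<le>
      norm (exp_sum p (?A T S) a) + norm (exp_sum p (?A (insert x T) S) a)"
    by (simp add: norm_triangle_ineq4)
  \<comment> \<open>The induction hypothesis applies to both sums, so every negative condition
    doubles the bound.\<close>
  also have "\<dots> \<le> 2 ^ card S * sqrt (real p) + 2 ^ card S * sqrt (real p)"
    by (intro add_mono insert.IH)
  finally show ?case
    using insert.hyps by (simp add: mult.assoc mult.commute)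
qed

section \<open>Primitive roots\<close>

text \<open>If the order is a proper divisor of p - 1, a prime \<open>q\<close> dividing the
  cofactor makes the order divide (p - 1)/q; conversely (p - 1)/q is positive and too small to be a
  multiple of p - 1. This gives one power condition per prime factor, the shape needed for the
  exponential sum bound.\<close>

lemma primitive_root_iff_power_neq_1:
  assumes "prime p"
  shows "primitive_root p n \<longleftrightarrow> n \<in> {1..<p} \<and>
    (\<forall>q\<in>prime_factors (p - 1). [n ^ ((p - 1) div q) \<noteq> 1] (mod p))"
proof (cases "n \<in> {1..<p}")
  \<comment> \<open>Either \<open>n\<close> is at least \<open>p\<close>, or \<open>n = 0\<close>,
    whose order is the default value 0 and differs from p - 1.\<close>
  case False
  then show ?thesis
    using prime_gt_1_nat[OF assms] by (cases "n = 0") (auto simp: primitive_root_def)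
next
  case True
  have p1: "p - 1 > 0" using prime_gt_1_nat[OF assms] by simp
  have cop: "coprime n p"
    using True assms
    by (metis atLeastLessThan_iff coprime_commute nat_dvd_not_less not_one_le_zero neq0_conv prime_imp_coprime)
  then have fermat: "[n ^ (p - 1) = 1] (mod p)"
    using euler_theorem[OF cop] assms by (simp add: totient_prime)
  then have dvd: "ord p n dvd p - 1" by (simp only: ord_divides)
  show ?thesis
  proof (cases "ord p n = p - 1")
    case eq: True
    have "[n ^ ((p - 1) div q) \<noteq> 1] (mod p)" if q: "q \<in> prime_factors (p - 1)" for q
    proof
      assume "[n ^ ((p - 1) div q) = 1] (mod p)"
      then have "p - 1 dvd (p - 1) div q" by (simp only: ord_divides eq)
      moreover have "(p - 1) div q < p - 1"
        using q p1 by (intro div_less_dividend prime_gt_1_nat) auto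
      moreover have "(p - 1) div q > 0"
        using q p1 by (simp add: div_greater_zero_iff prime_gt_0_nat dvd_imp_le prime_factors_dvd)
      ultimately show False
        using nat_dvd_not_less by blast
    qed
    then show ?thesis using True eq by (simp add: primitive_root_def)
  next
    case neq: False
    obtain c where c: "p - 1 = ord p n * c" using dvd by blast
    have "c \<noteq> 1" using c neq by auto
    then obtain q where q: "prime q" "q dvd c" using prime_factor_nat by blast
    then obtain c' where c': "c = q * c'" by blast
    have "q \<in> prime_factors (p - 1)"
      using q c p1 by (auto simp: prime_factors_dvd)
    moreover have "(p - 1) div q = ord p n * c'"
      using c c' q by (simp add: prime_gt_0_nat)
    then have "[n ^ ((p - 1) div q) = 1] (mod p)" by (simp only: ord_divides dvd_triv_left)
    ultimately show ?thesis using neq unfolding primitive_root_def by blast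
  qed
qed

text \<open>The case of no positive conditions and of the exponents (p - 1)/q as negative ones, at
  most one for each prime factor of p - 1.\<close>

lemma norm_exp_sum_primitive_roots_le:
  assumes p: "prime p" and a: "\<not> p dvd a"
  shows "norm (exp_sum p {n. primitive_root p n} a) \<le> 2 ^ card (prime_factors (p - 1)) * sqrt (real p)"
proof -
  let ?K = "(\<lambda>q. (p - 1) div q) ` prime_factors (p - 1)"
  have "{n. primitive_root p n} = {n \<in> {1..<p}. (\<forall>k\<in>{}. [n ^ k = 1] (mod p)) \<and>
      (\<forall>k\<in>?K. [n ^ k \<noteq> 1] (mod p))}"
    by (auto simp: primitive_root_iff_power_neq_1[OF p])
  then have "norm (exp_sum p {n. primitive_root p n} a) \<le> 2 ^ card ?K * sqrt (real p)"
    using norm_exp_sum_power_conditions_le[OF p _ a, of ?K "{}"] by simp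
  also have "\<dots> \<le> 2 ^ card (prime_factors (p - 1)) * sqrt (real p)"
    by (intro mult_right_mono power_increasing card_image_le) auto
  finally show ?thesis .
qed

text \<open>Primitive roots are the generators of the unit group, which is cyclic of order p -
  1.\<close>

lemma card_primitive_roots:
  assumes "prime p"
  shows "card {n. primitive_root p n} = totient (p - 1)"
proof -
  have p1: "p - 1 > 0" using prime_gt_1_nat[OF assms] by simp
  have "primitive_root p n \<longleftrightarrow> n \<in> totatives p \<and> ord p n = p - 1" for n
  proof
    assume n: "primitive_root p n"
    then have "ord p n > 0" using p1 by (simp add: primitive_root_def)
    then show "n \<in> totatives p \<and> ord p n = p - 1"
      using n p1 primitive_root_iff_power_neq_1[OF assms, of n]
      by (simp add: primitive_root_def totatives_def coprime_commute)
  next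
    assume n: "n \<in> totatives p \<and> ord p n = p - 1"
    then have "n < p" using p1 totatives_less by simp
    with n show "primitive_root p n" by (simp add: primitive_root_def)
  qed
  then have "{n. primitive_root p n} = {x \<in> totatives p. ord p x = p - 1}"
    by blast
  then show ?thesis
    using prime_card_elements_with_ord_eq_totient[OF prime_gt_1_nat[OF assms] assms, of "p - 1"]
    by simp
qed

section \<open>Equidistribution in progressions\<close>

text \<open>Sine lies above its chord on the first quarter period, and reflection covers the second.
  The weight x(1 - x) treats both ends alike, and its reciprocal splits as 1/x + 1/(1 - x).\<close>

lemma sin_pi_mult_ge:
  fixes x :: real
  assumes "0 \<le> x" "x \<le> 1"
  shows "2 * x * (1 - x) \<le> sin (pi * x)"
proof -
  have convex: "convex_on {0..pi / 2} (\<lambda>t. - sin t)"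
  proof (rule f''_ge0_imp_convex[where f' = "\<lambda>t. - cos t" and f'' = sin])
    show "0 \<le> sin t" if "t \<in> {0..pi / 2}" for t
      using that by (intro sin_ge_zero) auto
  qed (auto intro!: derivative_eq_intros)
  have half: "2 * y \<le> sin (pi * y)" if "0 \<le> y" "y \<le> 1 / 2" for y
    \<comment> \<open>The point \<open>pi * y\<close> divides the segment from 0 to
      \<open>pi / 2\<close> with weight \<open>2 * y\<close>.\<close>
    using convex_onD[OF convex, of "2 * y" 0 "pi / 2"] that by (simp add: mult.commute)
  show ?thesis
  proof (cases "x \<le> 1 / 2")
    case True
    have "2 * x * (1 - x) \<le> 2 * x * 1"
      using assms by (intro mult_left_mono) auto
    then show ?thesis using half[of x] True assms by simp
  next
    case False
    have "2 * (1 - x) * x \<le> 2 * (1 - x) * 1"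
      using assms by (intro mult_left_mono) auto
    moreover have "sin (pi * (1 - x)) = sin (pi * x)"
      by (simp add: right_diff_distrib)
    ultimately show ?thesis using half[of "1 - x"] False assms by (simp add: mult_ac)
  qed
qed

text \<open>A geometric sum with ratio \<open>z\<close> on the unit circle is at most 2/|1 - z|
  whatever its length, and |1 - z| is twice the sine of \<pi>b/p.\<close>

lemma norm_sum_additive_char_interval_le:
  assumes b: "0 < b" "b < p"
  shows "norm (\<Sum>m=1..M. additive_char p (int (b * m))) \<le> real p / 2 * (1 / real b + 1 / real (p - b))"
proof (cases "M = 0")
  case True
  then show ?thesis by simp
next
  case False
  define x where "x = real b / real p"
  define z where "z = additive_char p (int b)"
  have x: "0 < x" "x < 1" using b by (auto simp: x_def)
  have pos: "0 < 2 * x * (1 - x)" using x by simp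
  have "norm (1 - z) = 2 * \<bar>sin (pi * x)\<bar>"
    using dist_exp_i_1[of "2 * pi * x"]
    by (simp add: z_def x_def additive_char_def cis_conv_exp norm_minus_commute)
  then have nz: "norm (1 - z) \<ge> 2 * (2 * x * (1 - x))"
    using sin_pi_mult_ge[of x] x by simp
  then have z1: "z \<noteq> 1" using pos by auto
  have nz1: "norm z = 1" by (simp add: z_def)
  have "(\<Sum>m=1..M. additive_char p (int (b * m))) = (\<Sum>m=1..M. z ^ m)"
    by (intro sum.cong refl) (simp add: z_def mult.commute flip: additive_char_mult)
  also have "norm \<dots> = norm (z ^ 1 - z ^ Suc M) / norm (1 - z)"
    using False z1 by (simp add: sum_gp norm_divide)
  also have "\<dots> \<le> (1 + 1) / norm (1 - z)"
    by (intro divide_right_mono order_trans[OF norm_triangle_ineq4]) (auto simp: nz1 norm_mult norm_power)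
  also have "\<dots> \<le> (1 + 1) / (2 * (2 * x * (1 - x)))"
    using nz pos by (intro divide_left_mono mult_pos_pos) (use x in linarith)+
  also have "\<dots> = real p / 2 * (1 / real b + 1 / real (p - b))"
    using b by (simp add: x_def of_nat_diff field_simps)
  finally show ?thesis .
qed

text \<open>The sequence \<open>harm n - ln n\<close> decreases from its value 1 at
  \<open>n = 1\<close>.\<close>

lemma harm_le_one_plus_ln: "n > 0 \<Longrightarrow> (harm n :: real) \<le> 1 + ln (real n)"
  using euler_mascheroni_sequence_decreasing[of 1 n] by (simp add: harm_def)

text \<open>Both reciprocal terms sum to the same harmonic number, by the reflection
  \<open>b\<close> to \<open>p - b\<close>. Completing a sum therefore costs only a logarithm after
  division by \<open>p\<close>.\<close>

lemma sum_norm_additive_char_interval_le: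
  assumes "p > 1"
  shows "(\<Sum>b=1..<p. norm (\<Sum>m=1..M. additive_char p (int (b * m)))) \<le> real p * (1 + ln (real p))"
proof -
  have "(\<Sum>b=1..<p. norm (\<Sum>m=1..M. additive_char p (int (b * m)))) \<le>
      (\<Sum>b=1..<p. real p / 2 * (1 / real b + 1 / real (p - b)))"
    by (intro sum_mono norm_sum_additive_char_interval_le) auto
  also have "\<dots> = real p / 2 * ((\<Sum>b=1..<p. 1 / real b) + (\<Sum>b=1..<p. 1 / real (p - b)))"
    by (simp add: sum.distrib distrib_left sum_distrib_left)
  also have "(\<Sum>b=1..<p. 1 / real (p - b)) = (\<Sum>b=1..<p. 1 / real b)"
    by (rule sum.reindex_bij_witness[of _ "\<lambda>b. p - b" "\<lambda>b. p - b"]) auto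
  also have "(\<Sum>b=1..<p. 1 / real b) = harm (p - 1)"
    unfolding harm_def using assms by (intro sum.cong) (auto simp: inverse_eq_divide)
  also have "real p / 2 * (harm (p - 1) + harm (p - 1)) = real p * harm (p - 1)" by simp
  also have "\<dots> \<le> real p * (1 + ln (real p))"
  proof (intro mult_left_mono)
    have "harm (p - 1) \<le> 1 + ln (real (p - 1))"
      using assms by (intro harm_le_one_plus_ln) simp
    also have "\<dots> \<le> 1 + ln (real p)" using assms by simp
    finally show "harm (p - 1) \<le> 1 + ln (real p)" .
  qed simp
  finally show ?thesis .
qed

text \<open>Completing the sum over the progression as in the Polya--Vinogradov inequality.\<close>

lemma card_multiples_in_set_approx:
  assumes p: "prime p" and X: "X \<subseteq> {..<p}" and k: "\<not> p dvd k" and M: "k * M < p"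
    and B: "\<And>a. \<not> p dvd a \<Longrightarrow> norm (exp_sum p X a) \<le> B"
  shows "\<bar>real (card {m \<in> {1..M}. k * m \<in> X}) - real M * real (card X) / real p\<bar> \<le> B * (1 + ln (real p))"
proof -
  define Y where "Y = (\<lambda>m. k * m) ` {1..M}"
  define c where "c = card {m \<in> {1..M}. k * m \<in> X}"
  have p1: "p > 1" using p by (rule prime_gt_1_nat)
  have k0: "k > 0" using k by (cases "k = 0") auto
  have injk: "inj_on (\<lambda>m. k * m) A" for A using k0 by (simp add: inj_on_def)
  \<comment> \<open>\<open>B\<close> bounds a norm at frequency 1, which is not divisible by
    \<open>p\<close>.\<close>
  have B0: "B \<ge> 0" using p1 by (intro order_trans[OF norm_ge_zero B[of 1]]) simp
  \<comment> \<open>Since \<open>k * M < p\<close>, the progression does not wrap around modulo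
    \<open>p\<close>, so Plancherel counts true members of \<open>X\<close>.\<close>
  have Y: "Y \<subseteq> {..<p}"
  proof
    fix y assume "y \<in> Y"
    then obtain m where "y = k * m" "m \<in> {1..M}" unfolding Y_def by blast
    then show "y \<in> {..<p}" using M by (auto intro: le_less_trans[OF mult_le_mono2])
  qed
  have "X \<inter> Y = (\<lambda>m. k * m) ` {m \<in> {1..M}. k * m \<in> X}"
    by (auto simp: Y_def)
  then have card_XY: "card (X \<inter> Y) = c"
    using injk by (simp add: c_def card_image)
  \<comment> \<open>The transform of a progression with difference \<open>k\<close> is an interval
    sum at frequency \<open>a * k mod p\<close>. Multiplication by \<open>k\<close> permutes the
    nonzero frequencies, so the final bound is independent of \<open>k\<close>.\<close>
  have expY: "exp_sum p Y a = (\<Sum>m=1..M. additive_char p (int (a * k mod p * m)))" for a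
  proof -
    have "exp_sum p Y a = (\<Sum>m=1..M. additive_char p (int (a * (k * m))))"
      using injk by (simp add: exp_sum_def Y_def sum.reindex)
    also have "\<dots> = (\<Sum>m=1..M. additive_char p (int (a * k mod p * m)))"
      using p1 by (intro sum.cong refl additive_char_cong_nat)
        (auto simp: cong_def mod_mult_left_eq mult.assoc)
    finally show ?thesis .
  qed
  have bij: "bij_betw (\<lambda>a. k * a mod p) {1..<p} {1..<p}"
  proof -
    have "inj_on (\<lambda>a. k * a mod p) {1..<p}"
      by (rule inj_on_subset[OF mult_mod_prime_inj_on[OF p k]]) auto
    moreover have "k * a mod p \<in> {1..<p}" if "a \<in> {1..<p}" for a
    proof -
      have "\<not> p dvd a" using that by (auto dest: dvd_imp_le)
      then have "\<not> p dvd k * a" using p k by (simp add: prime_dvd_mult_iff)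
      then show ?thesis using p1 by (simp add: Suc_le_eq mod_greater_zero_iff_not_dvd)
    qed
    ultimately show ?thesis
      by (intro bij_betw_imageI endo_inj_surj) auto
  qed
  have "of_nat p * of_nat c = (\<Sum>a<p. exp_sum p X a * cnj (exp_sum p Y a))"
    using sum_exp_sum_cnj[OF X Y] card_XY by simp
  \<comment> \<open>Frequency 0 carries the expected main term; all others go into the
    error.\<close>
  also have "{..<p} = insert 0 {1..<p}" using p1 by auto
  also have "(\<Sum>a\<in>insert 0 {1..<p}. exp_sum p X a * cnj (exp_sum p Y a)) =
      of_nat (card X) * of_nat M + (\<Sum>a=1..<p. exp_sum p X a * cnj (exp_sum p Y a))"
    using injk by (simp add: exp_sum_0 Y_def card_image)
  finally have eq: "complex_of_real (real p * real c - real (card X) * real M) =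
      (\<Sum>a=1..<p. exp_sum p X a * cnj (exp_sum p Y a))" by simp
  have "\<bar>real p * real c - real (card X) * real M\<bar> =
      norm (complex_of_real (real p * real c - real (card X) * real M))"
    by (simp only: norm_of_real)
  also have "\<dots> \<le> (\<Sum>a=1..<p. norm (exp_sum p X a) * norm (exp_sum p Y a))"
    unfolding eq by (intro order_trans[OF norm_sum]) (simp add: norm_mult)
  also have "\<dots> \<le> (\<Sum>a=1..<p. B * norm (exp_sum p Y a))"
    by (intro sum_mono mult_right_mono B) (auto dest: dvd_imp_le)
  also have "\<dots> = B * (\<Sum>a=1..<p. norm (\<Sum>m=1..M. additive_char p (int (k * a mod p * m))))"
    by (simp add: sum_distrib_left expY mult.commute)
  also have "(\<Sum>a=1..<p. norm (\<Sum>m=1..M. additive_char p (int (k * a mod p * m)))) =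
      (\<Sum>b=1..<p. norm (\<Sum>m=1..M. additive_char p (int (b * m))))"
    by (rule sum.reindex_bij_betw[OF bij])
  also have "B * \<dots> \<le> B * (real p * (1 + ln (real p)))"
    using B0 p1 by (intro mult_left_mono sum_norm_additive_char_interval_le) auto
  finally have "\<bar>real p * real c - real (card X) * real M\<bar> / real p \<le> B * (1 + ln (real p))"
    using p1 by (simp add: field_simps)
  also have "\<bar>real p * real c - real (card X) * real M\<bar> / real p =
      \<bar>(real p * real c - real (card X) * real M) / real p\<bar>"
    using p1 by simp
  also have "(real p * real c - real (card X) * real M) / real p = real c - real M * real (card X) / real p"
    using p1 by (simp add: field_simps)
  finally show ?thesis by (simp add: c_def)
qed

section \<open>Squarefree numbers and the Euler product\<close>

lemma prod_primes_dvd: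
  fixes m :: nat
  assumes "m > 0" "S \<subseteq> prime_factors m"
  shows "\<Prod>S dvd m"
proof -
  have "\<Prod>S dvd (\<Prod>q\<in>prime_factors m. q ^ multiplicity q m)"
  proof (intro prod_dvd_prod_subset2)
    show "q dvd q ^ multiplicity q m" if "q \<in> S" for q
      using that assms(2) by (intro dvd_power) (auto simp: prime_factors_multiplicity)
  qed (use assms in auto)
  then show ?thesis
    using prime_factorization_nat[OF assms(1)] by simp
qed

lemma squarefree_eq_prod_prime_factors:
  fixes d :: nat
  assumes "squarefree d"
  shows "\<Prod>(prime_factors d) = d"
proof -
  have d: "d > 0" using assms by (cases "d = 0") auto
  have "\<Prod>(prime_factors d) = (\<Prod>q\<in>prime_factors d. q ^ multiplicity q d)"
    using assms d by (intro prod.cong) (auto simp: squarefree_factorial_semiring')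
  then show ?thesis
    using prime_factorization_nat[OF d] by simp
qed

lemma
  fixes S :: "nat set"
  assumes "finite S" "\<And>q. q \<in> S \<Longrightarrow> prime q"
  shows squarefree_prod_primes: "squarefree (\<Prod>S)"
    and prime_factors_prod_primes: "prime_factors (\<Prod>S) = S"
proof -
  show "squarefree (\<Prod>S)"
    using assms by (intro squarefree_prod_coprime) (auto intro: primes_coprime squarefree_prime)
  have "0 \<notin> S" using assms(2) by force
  then have "prime_factors (\<Prod>S) = (\<Union>q\<in>S. prime_factors q)"
    using assms(1) by (subst prime_factors_prod) auto
  also have "\<dots> = S" using assms(2) by (auto simp: prime_factorization_prime)
  finally show "prime_factors (\<Prod>S) = S" .
qed

lemma squarefree_dvd_iff:
  fixes d m :: nat
  assumes "squarefree d" "m > 0"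
  shows "d dvd m \<longleftrightarrow> prime_factors d \<subseteq> prime_factors m"
  using assms prod_primes_dvd[of m "prime_factors d"] squarefree_eq_prod_prime_factors[of d]
  by (metis dvd_prime_factors neq0_conv)

text \<open>A squarefree number is determined by its set of prime factors. This turns an expanded
  product over primes into a sum over squarefree numbers.\<close>

lemma bij_betw_squarefree_Pow:
  fixes A :: "nat set"
  assumes "finite A" "\<And>q. q \<in> A \<Longrightarrow> prime q"
  shows "bij_betw Prod (Pow A) {d. squarefree d \<and> prime_factors d \<subseteq> A}"
proof (rule bij_betw_byWitness[where f' = prime_factors])
  have S: "finite S" "\<And>q. q \<in> S \<Longrightarrow> prime q" if "S \<subseteq> A" for S
    using that assms finite_subset by auto
  show "\<forall>S\<in>Pow A. prime_factors (\<Prod>S) = S"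
    using S by (auto simp: prime_factors_prod_primes)
  show "Prod ` Pow A \<subseteq> {d. squarefree d \<and> prime_factors d \<subseteq> A}"
    using S by (auto simp: prime_factors_prod_primes intro!: squarefree_prod_primes)
qed (auto simp: squarefree_eq_prod_prime_factors)

lemma finite_squarefree_prime_factors_subset:
  fixes A :: "nat set"
  assumes "finite A" "\<And>q. q \<in> A \<Longrightarrow> prime q"
  shows "finite {d. squarefree d \<and> prime_factors d \<subseteq> A}"
  using bij_betw_finite[OF bij_betw_squarefree_Pow[OF assms]] assms(1) by auto

lemma sum_moebius_mu_squarefree:
  fixes h :: "nat \<Rightarrow> real"
  assumes A: "finite A" "\<And>q. q \<in> A \<Longrightarrow> prime q"
    and h: "h 1 = 1" "\<And>a b. h (a * b) = h a * h b"
  shows "(\<Sum>d | squarefree d \<and> prime_factors d \<subseteq> A. of_int (moebius_mu d) * h d) = (\<Prod>q\<in>A. 1 - h q)"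
proof -
  have hprod: "h (\<Prod>S) = (\<Prod>q\<in>S. h q)" if "finite S" for S
    using that h by (induction S rule: finite_induct) auto
  have "(\<Prod>q\<in>A. 1 - h q) = (\<Sum>S\<in>Pow A. (- 1) ^ card S * (\<Prod>q\<in>S. h q))"
    using prod_diff_conv_sum[OF A(1), of "\<lambda>_. 1" h] by simp
  also have "\<dots> = (\<Sum>S\<in>Pow A. of_int (moebius_mu (\<Prod>S)) * h (\<Prod>S))"
  proof (intro sum.cong refl)
    fix S assume "S \<in> Pow A"
    then have S: "finite S" "\<And>q. q \<in> S \<Longrightarrow> prime q" using A finite_subset by auto
    show "(- 1) ^ card S * (\<Prod>q\<in>S. h q) = of_int (moebius_mu (\<Prod>S)) * h (\<Prod>S)"
      using S by (simp add: moebius_mu_def squarefree_prod_primes prime_factors_prod_primes hprod)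
  qed
  also have "\<dots> = (\<Sum>d | squarefree d \<and> prime_factors d \<subseteq> A. of_int (moebius_mu d) * h d)"
    by (rule sum.reindex_bij_betw[OF bij_betw_squarefree_Pow[OF A]])
  finally show ?thesis by simp
qed

text \<open>The condition \<open>d\<^sup>2 dvd n\<close> says that \<open>d\<close> divides the
  square part of \<open>n\<close>, and non-squarefree \<open>d\<close> contribute 0. The cutoff
  \<open>N\<close> loses nothing, as such \<open>d\<close> are at most \<open>n\<close>.\<close>

lemma sum_moebius_mu_square_dvd:
  fixes n N :: nat
  assumes n: "0 < n" "n < N"
  shows "(\<Sum>d=1..<N. if d\<^sup>2 dvd n then real_of_int (moebius_mu d) else 0) = of_bool (squarefree n)"
proof -
  let ?m = "square_part n"
  have m: "?m > 0" using n by (metis gr0I not_gr_zero square_part_0_iff)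
  have "(\<Sum>d=1..<N. if d\<^sup>2 dvd n then real_of_int (moebius_mu d) else 0) =
      (\<Sum>d\<in>{d \<in> {1..<N}. d\<^sup>2 dvd n}. real_of_int (moebius_mu d))"
    by (rule sum.inter_filter[symmetric]) simp
  also have "\<dots> = (\<Sum>d | squarefree d \<and> prime_factors d \<subseteq> prime_factors ?m. real_of_int (moebius_mu d))"
  proof (rule sum.mono_neutral_right)
    show "{d. squarefree d \<and> prime_factors d \<subseteq> prime_factors ?m} \<subseteq> {d \<in> {1..<N}. d\<^sup>2 dvd n}"
    proof safe
      fix d assume d: "squarefree d" "prime_factors d \<subseteq> prime_factors ?m"
      then show dn: "d\<^sup>2 dvd n"
        using m by (simp add: squarefree_dvd_iff flip: dvd_square_part_iff)
      have "d dvd n" using dn by (metis dvd_mult_left power2_eq_square)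
      then have "d \<noteq> 0" "d \<le> n" using n by (auto dest: dvd_imp_le)
      then show "d \<in> {1..<N}" using n by simp
    qed
    show "\<forall>d\<in>{d \<in> {1..<N}. d\<^sup>2 dvd n} - {d. squarefree d \<and> prime_factors d \<subseteq> prime_factors ?m}.
        real_of_int (moebius_mu d) = 0"
      using m by (auto simp: moebius_mu_def squarefree_dvd_iff simp flip: dvd_square_part_iff)
  qed simp
  \<comment> \<open>With \<open>h\<close> constantly 1 every factor is 1 - 1, so the product is 1
    exactly when it is empty.\<close>
  also have "\<dots> = (\<Prod>q\<in>prime_factors ?m. 0)"
    using sum_moebius_mu_squarefree[of "prime_factors ?m" "\<lambda>_. 1"] by auto
  also have "\<dots> = of_bool (squarefree n)"
  proof -
    have "prime_factors ?m = {} \<longleftrightarrow> squarefree n"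
      using n m by (auto simp: squarefree_factorial_semiring prime_factors_dvd simp flip: dvd_square_part_iff)
    then show ?thesis by (cases "squarefree n") (auto simp: card_gt_0_iff)
  qed
  finally show ?thesis .
qed

section \<open>Tails of inverse squares and truncation of the Euler product\<close>

lemma sum_inverse_squares_le:
  assumes "0 < D" "D \<le> K"
  shows "(\<Sum>d\<in>{D<..K}. 1 / (real d)\<^sup>2) \<le> 1 / real D - 1 / real K"
  using assms(2)
proof (induction K rule: dec_induct)
  case (step K)
  have K: "K > 0" using step assms by simp
  have "{D<..Suc K} = insert (Suc K) {D<..K}" using step by auto
  then have "(\<Sum>d\<in>{D<..Suc K}. 1 / (real d)\<^sup>2) = 1 / (real (Suc K))\<^sup>2 + (\<Sum>d\<in>{D<..K}. 1 / (real d)\<^sup>2)"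
    by simp
  also have "\<dots> \<le> 1 / (real (Suc K))\<^sup>2 + (1 / real D - 1 / real K)"
    using step.IH by simp
  \<comment> \<open>This comparison makes the sum telescope.\<close>
  also have "1 / (real (Suc K))\<^sup>2 \<le> 1 / (real K * real (Suc K))"
    using K by (intro divide_left_mono) (auto simp: power2_eq_square)
  also have "1 / (real K * real (Suc K)) = 1 / real K - 1 / real (Suc K)"
    using K by (simp add: field_simps)
  finally show ?case by simp
qed simp

lemma sum_inverse_squares_tail_le:
  assumes "0 < D" "finite S" "S \<subseteq> {D<..}"
  shows "(\<Sum>d\<in>S. 1 / (real d)\<^sup>2) \<le> 1 / real D"
proof -
  define K where "K = Max (insert D S)"
  have "D \<le> K" using assms by (simp add: K_def)
  have "S \<subseteq> {D<..K}" using assms by (auto simp: K_def)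
  then have "(\<Sum>d\<in>S. 1 / (real d)\<^sup>2) \<le> (\<Sum>d\<in>{D<..K}. 1 / (real d)\<^sup>2)"
    by (intro sum_mono2) auto
  also have "\<dots> \<le> 1 / real D - 1 / real K"
    using assms \<open>D \<le> K\<close> by (intro sum_inverse_squares_le)
  also have "\<dots> \<le> 1 / real D" by simp
  finally show ?thesis .
qed

lemma abs_moebius_mu_le_1: "\<bar>real_of_int (moebius_mu n)\<bar> \<le> 1"
  by (simp add: moebius_mu_def power_abs)

lemma prodinf_squarefree_factor_approx:
  assumes "D > 0"
  shows "\<bar>prodinf squarefree_factor - (\<Sum>d=1..D. of_int (moebius_mu d) / (real d)\<^sup>2)\<bar> \<le> 1 / real D"
proof -
  let ?s = "\<Sum>d=1..D. of_int (moebius_mu d) / (real d)\<^sup>2"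
  have "\<bar>(\<Prod>q\<le>N. squarefree_factor q) - ?s\<bar> \<le> 1 / real D" if "N \<ge> D" for N
  proof -
    let ?A = "{q. prime q \<and> q \<le> N}"
    let ?U = "{d. squarefree d \<and> prime_factors d \<subseteq> ?A}"
    let ?f = "\<lambda>d. of_int (moebius_mu d) / (real d)\<^sup>2"
    have finU: "finite ?U"
      by (rule finite_squarefree_prime_factors_subset) auto
    have "(\<Prod>q\<le>N. squarefree_factor q) = (\<Prod>q\<in>?A. 1 - 1 / (real q)\<^sup>2)"
      unfolding squarefree_factor_def
      by (subst prod.inter_filter[symmetric]) (auto intro!: prod.cong)
    also have "\<dots> = (\<Sum>d\<in>?U. of_int (moebius_mu d) * (1 / (real d)\<^sup>2))"
      by (rule sum_moebius_mu_squarefree[symmetric]) (auto simp: power_mult_distrib)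
    also have "\<dots> = (\<Sum>d\<in>?U. ?f d)" by simp
    also have "\<dots> = (\<Sum>d\<in>?U \<inter> {1..D}. ?f d) + (\<Sum>d\<in>?U - {1..D}. ?f d)"
      using finU by (rule sum.Int_Diff)
    also have "(\<Sum>d\<in>?U \<inter> {1..D}. ?f d) = ?s"
    proof (rule sum.mono_neutral_left)
      show "\<forall>d\<in>{1..D} - ?U \<inter> {1..D}. ?f d = 0"
      proof
        fix d assume d: "d \<in> {1..D} - ?U \<inter> {1..D}"
        have "prime_factors d \<subseteq> ?A"
          using d that by (auto simp: prime_factors_dvd dest!: dvd_imp_le)
        then have "\<not> squarefree d" using d by blast
        then show "?f d = 0" by (simp add: moebius_mu_def)
      qed
    qed auto
    finally have "\<bar>(\<Prod>q\<le>N. squarefree_factor q) - ?s\<bar> = \<bar>\<Sum>d\<in>?U - {1..D}. ?f d\<bar>" by simp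
    also have "\<dots> \<le> (\<Sum>d\<in>?U - {1..D}. 1 / (real d)\<^sup>2)"
      by (intro order_trans[OF sum_abs] sum_mono) (simp add: divide_right_mono abs_moebius_mu_le_1)
    also have "\<dots> \<le> 1 / real D"
    proof (rule sum_inverse_squares_tail_le)
      \<comment> \<open>Zero also lies outside \<open>{1..D}\<close>; not being squarefree keeps it
        out of the tail.\<close>
      have "0 \<notin> ?U" by simp
      then show "?U - {1..D} \<subseteq> {D<..}"
        by (metis (no_types, lifting) Diff_iff atLeastAtMost_iff greaterThan_iff less_one linorder_not_le subsetI)
    qed (use assms finU in auto)
    finally show ?thesis .
  qed
  moreover have "(\<lambda>N. \<bar>(\<Prod>q\<le>N. squarefree_factor q) - ?s\<bar>) \<longlonglongrightarrow> \<bar>prodinf squarefree_factor - ?s\<bar>"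
    by (intro tendsto_intros convergent_prod_LIMSEQ convergent_prod_squarefree_factor)
  ultimately show ?thesis
    by (intro LIMSEQ_le_const2) auto
qed

text \<open>Convergence in the sense of \<open>convergent_prod\<close> rules out a zero limit for
  positive factors. Positivity lets the main term dominate the error.\<close>

lemma prodinf_squarefree_factor_pos: "prodinf squarefree_factor > 0"
proof (rule has_prod_pos)
  show "squarefree_factor has_prod prodinf squarefree_factor"
    using convergent_prod_squarefree_factor by (rule convergent_prod_has_prod)
  show "squarefree_factor q > 0" for q
    by (auto simp: squarefree_factor_def dest: prime_gt_1_nat)
qed

section \<open>Counting squarefree primitive roots\<close>

lemma real_div_nat_approx:
  fixes p k :: nat
  assumes "p > 0" "k > 0"
  shows "\<bar>real ((p - 1) div k) - real p / real k\<bar> \<le> 1"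
proof -
  have "(p - 1) div k * k \<le> p - 1" by simp
  then have "(p - 1) div k * k \<le> p" by linarith
  then have "real ((p - 1) div k * k) \<le> real p" by (simp only: of_nat_le_iff)
  then have 1: "real ((p - 1) div k) \<le> real p / real k"
    using assms by (simp add: field_simps)
  \<comment> \<open>Strictness here absorbs the shift from p - 1 to \<open>p\<close>.\<close>
  have "p - 1 < k + k * ((p - 1) div k)"
    using assms by (intro dividend_less_times_div) simp
  then have "p \<le> k * ((p - 1) div k) + k" by linarith
  then have "real p \<le> real (k * ((p - 1) div k) + k)" by (simp only: of_nat_le_iff)
  then have "real p / real k \<le> real ((p - 1) div k) + 1"
    using assms by (simp add: field_simps)
  with 1 show ?thesis by linarith
qed

lemma card_square_dvd_primitive_roots_eq:
  assumes p: "prime p" and d: "0 < d"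
  shows "card {n. primitive_root p n \<and> d\<^sup>2 dvd n} =
    card {m \<in> {1..(p - 1) div d\<^sup>2}. d\<^sup>2 * m \<in> {n. primitive_root p n}}"
proof -
  have "{n. primitive_root p n \<and> d\<^sup>2 dvd n} =
      (\<lambda>m. d\<^sup>2 * m) ` {m \<in> {1..(p - 1) div d\<^sup>2}. d\<^sup>2 * m \<in> {n. primitive_root p n}}"
  proof (intro equalityI subsetI)
    fix n assume n: "n \<in> {n. primitive_root p n \<and> d\<^sup>2 dvd n}"
    then obtain m where m: "n = d\<^sup>2 * m" by blast
    have "1 \<le> n" "n < p" using n primitive_root_iff_power_neq_1[OF p, of n] by auto
    then have "m \<in> {1..(p - 1) div d\<^sup>2}"
      using m d by (cases "m = 0") (auto simp: less_eq_div_iff_mult_less_eq mult.commute)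
    then show "n \<in> (\<lambda>m. d\<^sup>2 * m) ` {m \<in> {1..(p - 1) div d\<^sup>2}. d\<^sup>2 * m \<in> {n. primitive_root p n}}"
      using n m by blast
  qed auto
  then show ?thesis
    using d by (simp add: card_image inj_on_def)
qed

text \<open>Counts all positive multiples of \<open>d\<^sup>2\<close> below \<open>p\<close>. This
  serves large \<open>d\<close>, where the Fourier error would be summed too often.\<close>

lemma card_square_dvd_primitive_roots_le:
  assumes "prime p" "0 < d"
  shows "real (card {n. primitive_root p n \<and> d\<^sup>2 dvd n}) \<le> real p / (real d)\<^sup>2"
proof -
  have "card {n. primitive_root p n \<and> d\<^sup>2 dvd n} \<le> card {1..(p - 1) div d\<^sup>2}"
    unfolding card_square_dvd_primitive_roots_eq[OF assms] by (intro card_mono) auto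
  also have "\<dots> \<le> p div d\<^sup>2" by (simp add: div_le_mono)
  finally have "real (card {n. primitive_root p n \<and> d\<^sup>2 dvd n}) \<le> real (p div d\<^sup>2)" by simp
  also have "\<dots> \<le> real p / (real d)\<^sup>2"
    using of_nat_div_le_of_nat[of p "d\<^sup>2"] by simp
  finally show ?thesis .
qed

lemma card_square_dvd_primitive_roots_approx:
  assumes p: "prime p" and d: "0 < d" "d < p"
  shows "\<bar>real (card {n. primitive_root p n \<and> d\<^sup>2 dvd n}) - real (totient (p - 1)) / (real d)\<^sup>2\<bar>
    \<le> 2 ^ card (prime_factors (p - 1)) * sqrt (real p) * (1 + ln (real p)) + 1"
proof -
  define M where "M = (p - 1) div d\<^sup>2"
  define c where "c = real (card {n. primitive_root p n \<and> d\<^sup>2 dvd n})"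
  let ?\<phi> = "real (totient (p - 1))"
  let ?E = "2 ^ card (prime_factors (p - 1)) * sqrt (real p) * (1 + ln (real p))"
  have p1: "p > 1" using p by (rule prime_gt_1_nat)
  have "\<not> p dvd d" using d by (auto dest: dvd_imp_le)
  then have pd: "\<not> p dvd d\<^sup>2" using p by (simp add: prime_dvd_power_iff)
  have "d\<^sup>2 * M \<le> p - 1" by (simp add: M_def)
  then have M: "d\<^sup>2 * M < p" using p1 by linarith
  have "\<bar>c - real M * ?\<phi> / real p\<bar> \<le> ?E"
    using card_multiples_in_set_approx[OF p _ pd M norm_exp_sum_primitive_roots_le[OF p]]
    unfolding c_def card_square_dvd_primitive_roots_eq[OF p d(1)] M_def card_primitive_roots[OF p]
    by (auto simp: primitive_root_def)
  \<comment> \<open>Replacing the length \<open>M\<close> by p/d^2 costs a rounding error of at most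
    1, weighted by \<phi>(p - 1)/p, which is at most 1.\<close>
  moreover have "\<bar>real M * ?\<phi> / real p - ?\<phi> / (real d)\<^sup>2\<bar> \<le> 1"
  proof -
    have "real M * ?\<phi> / real p - ?\<phi> / (real d)\<^sup>2 = ?\<phi> / real p * (real M - real p / real (d\<^sup>2))"
      using p1 by (simp add: field_simps)
    also have "\<bar>\<dots>\<bar> = ?\<phi> / real p * \<bar>real M - real p / real (d\<^sup>2)\<bar>"
      by (simp only: abs_mult) simp
    also have "\<dots> \<le> 1 * 1"
    proof (intro mult_mono)
      have "totient (p - 1) \<le> p" using totient_le[of "p - 1"] by linarith
      then show "?\<phi> / real p \<le> 1" using p1 by simp
      show "\<bar>real M - real p / real (d\<^sup>2)\<bar> \<le> 1"
        unfolding M_def using p1 d by (intro real_div_nat_approx) auto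
    qed auto
    finally show ?thesis by simp
  qed
  ultimately have "\<bar>c - ?\<phi> / (real d)\<^sup>2\<bar> \<le> ?E + 1" by linarith
  then show ?thesis by (simp only: c_def)
qed

lemma N2_eq_card_squarefree:
  "N2 p = card {n. primitive_root p n \<and> squarefree n}"
proof -
  have "(moebius_mu n)\<^sup>2 = 1 \<longleftrightarrow> squarefree n" for n
    by (simp add: moebius_mu_def flip: power_mult)
  then show ?thesis by (simp add: N2_def)
qed

lemma N2_eq_sum_moebius_mu:
  assumes p: "prime p"
  shows "real (N2 p) = (\<Sum>d=1..<p. of_int (moebius_mu d) * real (card {n. primitive_root p n \<and> d\<^sup>2 dvd n}))"
proof -
  let ?X = "{n. primitive_root p n}"
  have fin: "finite ?X" by (rule finite_subset[of _ "{..<p}"]) (auto simp: primitive_root_def)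
  have "real (N2 p) = (\<Sum>n\<in>?X. of_bool (squarefree n))"
    using fin by (simp add: N2_eq_card_squarefree Int_def)
  also have "\<dots> = (\<Sum>n\<in>?X. \<Sum>d=1..<p. if d\<^sup>2 dvd n then real_of_int (moebius_mu d) else 0)"
    using primitive_root_iff_power_neq_1[OF p]
    by (intro sum.cong refl sum_moebius_mu_square_dvd[symmetric]) auto
  also have "\<dots> = (\<Sum>d=1..<p. \<Sum>n\<in>?X. if d\<^sup>2 dvd n then real_of_int (moebius_mu d) else 0)"
    by (rule sum.swap)
  also have "\<dots> = (\<Sum>d=1..<p. \<Sum>n\<in>{n \<in> ?X. d\<^sup>2 dvd n}. real_of_int (moebius_mu d))"
    using fin by (intro sum.cong refl sum.inter_filter[symmetric])
  finally show ?thesis by (simp add: mult.commute)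
qed

text \<open>Three errors are added: the Fourier error for \<open>d \<le> D\<close>, the trivial
  bound for \<open>d > D\<close>, and the truncation of the Euler product. The last two contribute
  p/D each.\<close>

lemma N2_approx:
  assumes p: "prime p" and D: "0 < D" "D < p"
  shows "\<bar>real (N2 p) - prodinf squarefree_factor * real (totient (p - 1))\<bar> \<le>
    real D * (2 ^ card (prime_factors (p - 1)) * sqrt (real p) * (1 + ln (real p)) + 1) + 2 * real p / real D"
proof -
  define c where "c d = real (card {n. primitive_root p n \<and> d\<^sup>2 dvd n})" for d
  define \<mu> where "\<mu> d = real_of_int (moebius_mu d)" for d
  let ?\<phi> = "real (totient (p - 1))"
  let ?E = "2 ^ card (prime_factors (p - 1)) * sqrt (real p) * (1 + ln (real p)) + 1"
  let ?s = "\<Sum>d=1..D. \<mu> d / (real d)\<^sup>2"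
  have \<mu>: "\<bar>\<mu> d\<bar> \<le> 1" for d by (simp add: \<mu>_def abs_moebius_mu_le_1)
  have "{1..<p} = {1..D} \<union> {D<..<p}" using D by auto
  then have "real (N2 p) = (\<Sum>d\<in>{1..D} \<union> {D<..<p}. \<mu> d * c d)"
    using N2_eq_sum_moebius_mu[OF p] by (simp add: \<mu>_def c_def)
  also have "\<dots> = (\<Sum>d=1..D. \<mu> d * c d) + (\<Sum>d\<in>{D<..<p}. \<mu> d * c d)"
    by (rule sum.union_disjoint) auto
  also have "(\<Sum>d=1..D. \<mu> d * c d) = (\<Sum>d=1..D. \<mu> d * (c d - ?\<phi> / (real d)\<^sup>2)) + ?s * ?\<phi>"
    by (simp add: right_diff_distrib sum_subtractf sum_distrib_right)
  finally have eq: "real (N2 p) - prodinf squarefree_factor * ?\<phi> =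
      (\<Sum>d=1..D. \<mu> d * (c d - ?\<phi> / (real d)\<^sup>2)) + (\<Sum>d\<in>{D<..<p}. \<mu> d * c d)
      - (prodinf squarefree_factor - ?s) * ?\<phi>"
    by (simp add: left_diff_distrib)
  have "\<bar>\<Sum>d=1..D. \<mu> d * (c d - ?\<phi> / (real d)\<^sup>2)\<bar> \<le> (\<Sum>d=1..D. 1 * ?E)" (is "\<bar>?S1\<bar> \<le> _")
    using D p
    by (intro order_trans[OF sum_abs] sum_mono, unfold abs_mult c_def, intro mult_mono \<mu>
        card_square_dvd_primitive_roots_approx) auto
  also have "\<dots> = real D * ?E" by simp
  finally have S1: "\<bar>?S1\<bar> \<le> real D * ?E" .
  have S2: "\<bar>\<Sum>d\<in>{D<..<p}. \<mu> d * c d\<bar> \<le> real p / real D" (is "\<bar>?S2\<bar> \<le> _")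
  proof -
    have "\<bar>\<Sum>d\<in>{D<..<p}. \<mu> d * c d\<bar> \<le> (\<Sum>d\<in>{D<..<p}. 1 * (real p / (real d)\<^sup>2))"
      using p
      by (intro order_trans[OF sum_abs] sum_mono, unfold abs_mult c_def, intro mult_mono \<mu>)
        (auto intro!: card_square_dvd_primitive_roots_le)
    also have "\<dots> = real p * (\<Sum>d\<in>{D<..<p}. 1 / (real d)\<^sup>2)"
      by (simp add: sum_distrib_left)
    also have "\<dots> \<le> real p * (1 / real D)"
      using D by (intro mult_left_mono sum_inverse_squares_tail_le) auto
    finally show ?thesis by simp
  qed
  have S3: "\<bar>(prodinf squarefree_factor - ?s) * ?\<phi>\<bar> \<le> real p / real D" (is "\<bar>?S3\<bar> \<le> _")
  proof -
    have "totient (p - 1) \<le> p" using totient_le[of "p - 1"] by linarith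
    then have "\<bar>(prodinf squarefree_factor - ?s) * ?\<phi>\<bar> \<le> 1 / real D * real p"
      unfolding abs_mult \<mu>_def using D
      by (intro mult_mono prodinf_squarefree_factor_approx) auto
    then show ?thesis by simp
  qed
  have "\<bar>?S1 + ?S2 - ?S3\<bar> \<le> real D * ?E + (real p / real D + real p / real D)"
    using S1 S2 S3 by linarith
  also have "real p / real D + real p / real D = 2 * real p / real D" by simp
  finally show ?thesis
    unfolding eq .
qed

section \<open>Bounds for the number of prime factors and for the totient\<close>

lemma prod_prime_factors_le:
  fixes n :: nat
  assumes "n > 0"
  shows "\<Prod>(prime_factors n) \<le> n"
  using prod_primes_dvd[OF assms order_refl] assms by (auto dest: dvd_imp_le)

text \<open>A factor 2 is at most q^\<delta> for every large prime \<open>q\<close>, and fewer than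
  \<open>K\<close> small primes remain, costing at most \<open>2 ^ K\<close>. The product of the
  prime factors is at most \<open>n\<close>.\<close>

lemma two_power_card_prime_factors_bound:
  fixes \<delta> :: real
  assumes "\<delta> > 0"
  obtains C where "C > 0" "\<And>n. n > 0 \<Longrightarrow> 2 ^ card (prime_factors n) \<le> C * real n powr \<delta>"
proof
  \<comment> \<open>The threshold from which q^\<delta> is at least 2.\<close>
  define K where "K = nat \<lceil>2 powr (1 / \<delta>)\<rceil>"
  have K: "2 \<le> real q powr \<delta>" if "q \<ge> K" for q
  proof -
    have "2 powr (1 / \<delta>) \<le> real q" using that unfolding K_def by linarith
    then have "(2 powr (1 / \<delta>)) powr \<delta> \<le> real q powr \<delta>"
      using assms by (intro powr_mono2) auto
    then show ?thesis using assms by (simp add: powr_powr)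
  qed
  show "(2::real) ^ K > 0" by simp
  fix n :: nat assume n: "n > 0"
  let ?P = "prime_factors n"
  have prod_powr: "(\<Prod>q\<in>S. real q powr \<delta>) = real (\<Prod>S) powr \<delta>" for S :: "nat set"
    by (induction S rule: infinite_finite_induct) (auto simp: powr_mult)
  have "2 ^ card ?P = (\<Prod>q\<in>?P. 2 :: real)" by simp
  also have "\<dots> \<le> (\<Prod>q\<in>?P. (if q < K then 2 else 1) * real q powr \<delta>)"
  proof (intro prod_mono conjI)
    fix q assume q: "q \<in> ?P"
    then have "real q powr \<delta> \<ge> 1"
      using assms prime_ge_1_nat[of q] by (intro ge_one_powr_ge_zero) auto
    then show "2 \<le> (if q < K then 2 else 1) * real q powr \<delta>"
      using K[of q] by simp
  qed simp
  also have "\<dots> = (\<Prod>q\<in>?P. if q < K then 2 else 1) * real (\<Prod>?P) powr \<delta>"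
    by (simp add: prod.distrib prod_powr)
  also have "(\<Prod>q\<in>?P. if q < K then 2 else 1) = (2::real) ^ card {q \<in> ?P. q < K}"
    by (subst prod.inter_filter[symmetric]) auto
  also have "\<dots> * real (\<Prod>?P) powr \<delta> \<le> 2 ^ K * real n powr \<delta>"
  proof (intro mult_mono power_increasing powr_mono2)
    have "card {q \<in> ?P. q < K} \<le> card {..<K}" by (intro card_mono) auto
    then show "card {q \<in> ?P. q < K} \<le> K" by simp
    show "real (\<Prod>?P) \<le> real n" using prod_prime_factors_le[OF n] by (simp only: of_nat_le_iff)
    show "0 \<le> real (\<Prod>?P)" by (rule of_nat_0_le_iff)
  qed (use assms in auto)
  finally show "2 ^ card ?P \<le> 2 ^ K * real n powr \<delta>" .
qed

text \<open>Each Euler factor 1 - 1/q is at least 1/2. The loss is only a small power of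
  \<open>n\<close> by the preceding bound.\<close>

lemma totient_ge:
  "real n / 2 ^ card (prime_factors n) \<le> real (totient n)"
proof -
  have "(1 / 2 :: real) ^ card (prime_factors n) = (\<Prod>q\<in>prime_factors n. 1 / 2)" by simp
  also have "\<dots> \<le> (\<Prod>q\<in>prime_factors n. 1 - 1 / real q)"
  proof (intro prod_mono conjI)
    fix q assume "q \<in> prime_factors n"
    then have "q \<ge> 2" using prime_ge_2_nat by auto
    then show "1 / 2 \<le> 1 - 1 / real q" by (simp add: field_simps)
  qed simp
  finally have "real n * (1 / 2) ^ card (prime_factors n) \<le> real (totient n)"
    unfolding totient_formula2 by (intro mult_left_mono) auto
  then show ?thesis by (simp add: power_divide)
qed

section \<open>Choice of the cutoff and asymptotic estimates\<close>

lemma N2_error_bound: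
  obtains K where "K > 0"
    "\<forall>\<^sub>F p in at_top. prime p \<longrightarrow>
      \<bar>real (N2 p) - prodinf squarefree_factor * real (totient (p - 1))\<bar> \<le> K * real p powr (7 / 8)"
proof -
  obtain C where C: "C > 0"
      "\<And>n. n > 0 \<Longrightarrow> 2 ^ card (prime_factors n) \<le> C * real n powr (1 / 16)"
    using two_power_card_prime_factors_bound[of "1 / 16"] by auto
  \<comment> \<open>With the cutoff near p^(1/4), the Fourier error has order p^(1/4 + 1/16 + 1/2)
    log p = p^(13/16) log p and the tails have order p^(3/4); both fit below p^(7/8).\<close>
  have ev: "\<forall>\<^sub>F p in at_top. real p powr (1 / 4) + 1 < real p"
    "\<forall>\<^sub>F p in at_top. real p powr (1 / 4) + 1 \<le> 2 * real p powr (1 / 4)"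
    "\<forall>\<^sub>F p in at_top. 2 * real p powr (1 / 4) * (real p powr (1 / 16) * real p powr (1 / 2) * (1 + ln (real p)))
      \<le> real p powr (7 / 8)"
    "\<forall>\<^sub>F p in at_top. 2 * real p powr (1 / 4) \<le> real p powr (7 / 8)"
    "\<forall>\<^sub>F p in at_top. 2 * real p powr (3 / 4) \<le> real p powr (7 / 8)"
    by real_asymp+
  have "\<forall>\<^sub>F p in at_top. prime p \<longrightarrow>
      \<bar>real (N2 p) - prodinf squarefree_factor * real (totient (p - 1))\<bar> \<le> (C + 2) * real p powr (7 / 8)"
    using ev
  proof eventually_elim
    case (elim p)
    show ?case
    proof
      assume p: "prime p"
      let ?D = "nat \<lceil>real p powr (1 / 4)\<rceil>"
      let ?\<omega> = "card (prime_factors (p - 1))"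
      have p1: "p > 1" using p by (rule prime_gt_1_nat)
      have pos: "real p powr (1 / 4) > 0" using p1 by simp
      \<comment> \<open>The lower bound for the ceiling controls the tails p/D, the upper bound
        controls the factor D before the Fourier error.\<close>
      have D_ge: "real p powr (1 / 4) \<le> real ?D" by linarith
      have "real ?D \<le> real p powr (1 / 4) + 1" using pos by linarith
      then have D_le: "real ?D \<le> 2 * real p powr (1 / 4)" and D_less: "?D < p"
        using elim(1,2) by linarith+
      have D_pos: "?D > 0" using D_ge pos by linarith
      have "2 ^ ?\<omega> \<le> C * real (p - 1) powr (1 / 16)" using C(2)[of "p - 1"] p1 by simp
      also have "\<dots> \<le> C * real p powr (1 / 16)"
        using C(1) by (intro mult_left_mono powr_mono2) auto
      finally have \<omega>: "2 ^ ?\<omega> \<le> C * real p powr (1 / 16)" .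
      have ln: "0 \<le> 1 + ln (real p)" using p1 by (simp add: add_nonneg_nonneg)
      have "\<bar>real (N2 p) - prodinf squarefree_factor * real (totient (p - 1))\<bar> \<le>
          real ?D * (2 ^ ?\<omega> * sqrt (real p) * (1 + ln (real p)) + 1) + 2 * real p / real ?D"
        by (rule N2_approx[OF p D_pos D_less])
      also have "\<dots> \<le> 2 * real p powr (1 / 4) *
            (C * real p powr (1 / 16) * real p powr (1 / 2) * (1 + ln (real p)) + 1) +
          2 * real p / real p powr (1 / 4)"
        using \<omega> ln C(1) D_ge D_le pos p1
        by (intro add_mono mult_mono divide_left_mono mult_pos_pos add_nonneg_nonneg mult_nonneg_nonneg)
          (auto simp: powr_half_sqrt)
      also have "\<dots> = C * (2 * real p powr (1 / 4) *
            (real p powr (1 / 16) * real p powr (1 / 2) * (1 + ln (real p)))) +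
          2 * real p powr (1 / 4) + 2 * (real p powr 1 / real p powr (1 / 4))"
        using p1 by (simp add: algebra_simps)
      also have "real p powr 1 / real p powr (1 / 4) = real p powr (3 / 4)"
        using powr_diff[of "real p" 1 "1 / 4"] by simp
      also have "C * (2 * real p powr (1 / 4) *
            (real p powr (1 / 16) * real p powr (1 / 2) * (1 + ln (real p)))) +
          2 * real p powr (1 / 4) + 2 * real p powr (3 / 4) \<le>
          C * real p powr (7 / 8) + real p powr (7 / 8) + real p powr (7 / 8)"
        using C(1) elim(3-5) by (intro add_mono mult_left_mono) auto
      finally show "\<bar>real (N2 p) - prodinf squarefree_factor * real (totient (p - 1))\<bar> \<le>
          (C + 2) * real p powr (7 / 8)"
        by (simp add: algebra_simps)
    qed
  qed
  then show ?thesis using C(1) by (intro that[of "C + 2"]) auto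
qed

text \<open>Up to constants the main term is at least (p - 1)^(15/16), by the lower bound for the
  totient, which exceeds the error p^(7/8).\<close>

lemma eventually_N2_pos: "\<forall>\<^sub>F p in at_top. prime p \<longrightarrow> N2 p > 0"
proof -
  obtain K where K: "\<forall>\<^sub>F p in at_top. prime p \<longrightarrow>
      \<bar>real (N2 p) - prodinf squarefree_factor * real (totient (p - 1))\<bar> \<le> K * real p powr (7 / 8)"
    using N2_error_bound by blast
  obtain C where C: "C > 0"
      "\<And>n. n > 0 \<Longrightarrow> 2 ^ card (prime_factors n) \<le> C * real n powr (1 / 16)"
    using two_power_card_prime_factors_bound[of "1 / 16"] by auto
  have "filterlim (\<lambda>p. real (p - 1) powr (15 / 16) / real p powr (7 / 8)) at_top at_top"
    by real_asymp
  \<comment> \<open>The threshold gathers the error constant, the loss in the totient bound and the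
    Euler product, so that clearing denominators compares main term with error.\<close>
  then have "\<forall>\<^sub>F p in at_top. real (p - 1) powr (15 / 16) / real p powr (7 / 8) > K * C / prodinf squarefree_factor"
    by (simp add: filterlim_at_top_dense)
  from this K show ?thesis
  proof eventually_elim
    case (elim p)
    show ?case
    proof
      assume p: "prime p"
      let ?\<Pi> = "prodinf squarefree_factor"
      let ?\<omega> = "card (prime_factors (p - 1))"
      have p1: "p > 1" using p by (rule prime_gt_1_nat)
      note pos = prodinf_squarefree_factor_pos
      have "K * C / ?\<Pi> * real p powr (7 / 8) < real (p - 1) powr (15 / 16)"
        using elim(1) p1 by (simp add: pos_less_divide_eq)
      then have "K * real p powr (7 / 8) < ?\<Pi> * (real (p - 1) powr (15 / 16) / C)"
        using pos C(1) by (simp add: field_simps)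
      also have "real (p - 1) powr (15 / 16) / C = real (p - 1) / (C * real (p - 1) powr (1 / 16))"
        using p1 powr_diff[of "real (p - 1)" 1 "1 / 16"] by simp
      also have "\<dots> \<le> real (p - 1) / 2 ^ ?\<omega>"
        using C(1) p1 by (intro divide_left_mono C(2)) auto
      also have "\<dots> \<le> real (totient (p - 1))" by (rule totient_ge)
      finally have "K * real p powr (7 / 8) < ?\<Pi> * real (totient (p - 1))"
        using pos by simp
      moreover have "\<bar>real (N2 p) - ?\<Pi> * real (totient (p - 1))\<bar> \<le> K * real p powr (7 / 8)"
        using elim(2) p by blast
      ultimately have "real (N2 p) > 0" by linarith
      then show "N2 p > 0" by simp
    qed
  qed
qed

text \<open>The error exponent 7/8 permits every \<open>\<epsilon>\<close> up to 1/8, since smaller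
  values only weaken the bound. The filter restricts the O-term to primes tending to
  infinity.\<close>

theorem theorem17p1:
  shows "(\<forall>\<^sub>F p in at_top. prime p \<longrightarrow> (\<exists>n. primitive_root p n \<and> squarefree n)) \<and>
    (\<exists>\<epsilon>\<^sub>0 > 0. \<forall>\<epsilon>::real. 0 < \<epsilon> \<and> \<epsilon> \<le> \<epsilon>\<^sub>0 \<longrightarrow>
      (\<lambda>p. real (N2 p) - prodinf squarefree_factor * (real (totient (p - 1)) / real p) * real p)
        \<in> O[inf at_top (principal {p. prime p})](\<lambda>p. real p powr (1 - \<epsilon>)))"
proof (intro conjI exI[of _ "1 / 8"] allI impI)
  show "\<forall>\<^sub>F p in at_top. prime p \<longrightarrow> (\<exists>n. primitive_root p n \<and> squarefree n)"
    using eventually_N2_pos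
    by eventually_elim (auto simp: N2_eq_card_squarefree card_gt_0_iff)
next
  fix \<epsilon> :: real
  assume \<epsilon>: "0 < \<epsilon> \<and> \<epsilon> \<le> 1 / 8"
  obtain K where K: "K > 0" "\<forall>\<^sub>F p in at_top. prime p \<longrightarrow>
      \<bar>real (N2 p) - prodinf squarefree_factor * real (totient (p - 1))\<bar> \<le> K * real p powr (7 / 8)"
    using N2_error_bound by blast
  show "(\<lambda>p. real (N2 p) - prodinf squarefree_factor * (real (totient (p - 1)) / real p) * real p)
      \<in> O[inf at_top (principal {p. prime p})](\<lambda>p. real p powr (1 - \<epsilon>))"
  proof (rule bigoI[of _ K], unfold eventually_inf_principal, use K(2) in eventually_elim, intro impI)
    fix p :: nat
    assume *: "prime p \<longrightarrow>
        \<bar>real (N2 p) - prodinf squarefree_factor * real (totient (p - 1))\<bar> \<le> K * real p powr (7 / 8)"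
      and "p \<in> {p. prime p}"
    then have p: "prime p" by simp
    then have p1: "p > 1" by (rule prime_gt_1_nat)
    have "prodinf squarefree_factor * (real (totient (p - 1)) / real p) * real p =
        prodinf squarefree_factor * real (totient (p - 1))"
      using p1 by simp
    then have "norm (real (N2 p) - prodinf squarefree_factor * (real (totient (p - 1)) / real p) * real p)
        \<le> K * real p powr (7 / 8)"
      using * p by simp
    also have "\<dots> \<le> K * real p powr (1 - \<epsilon>)"
      using K(1) \<epsilon> p1 by (intro mult_left_mono powr_mono) auto
    finally show "norm (real (N2 p) - prodinf squarefree_factor * (real (totient (p - 1)) / real p) * real p)
        \<le> K * norm (real p powr (1 - \<epsilon>))"
      by simp
  qed
qed simp

end
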